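(* Let $n\ge2$ and let $V$ be an irreducible $J\oplus D$-module which is a weight module with respect to $\mathfrak h_0$ with finite dimensional weight spaces. Assume that there exist non-zero central operators $z_1,\dots,z_{n-1}$ on $V$ of degrees $(k_1,0,\dots,0),\dots,(0,\dots,0,k_{n-1},0)\in\mathbb Z^n$ respectively, where each $k_i$ is a positive integer. Let $W$ be a maximal $J\oplus D_{n-1}$-submodule of $V$ such that $V_1=V/W$ is an irreducible $J\oplus D_{n-1}$-module with finite dimensional weight spaces with respect to $\mathfrak h_{n-1}$. Then, for a suitable $\alpha\in\mathbb C^{n-1}$, $V$ is isomorphic as a $J\oplus D$-module to a component (irreducible direct summand) of the $J\oplus D$-module $(V_1\otimes A_{n-1},\pi(\alpha))$ (defined in the context).
   Context: $\mathfrak g$ is a finite dimensional simple Lie algebra over $\mathbb C$ with non-degenerate invariant symmetric bilinear form $(\cdot,\cdot)$ and Cartan subalgebra $\mathfrak h$. $\mathfrak g_{\rm aff}=\mathfrak g\otimes\mathbb C[t_n^{\pm1}]\oplus\mathbb C K_n$ with $[x\otimes t_n^a,y\otimes t_n^b]=[x,y]\otimes t_n^{a+b}+a\,\delta_{a+b,0}(x,y)K_n$ and $K_n$ central. $A_{n-1}=\mathbb C[t_1^{\pm1},\dots,t_{n-1}^{\pm1}]$, $t^{\overline m}=t_1^{m_1}\cdots t_{n-1}^{m_{n-1}}$, and $J=\mathfrak g_{\rm aff}\otimes A_{n-1}$ with bracket $[X\otimes f,Y\otimes g]=[X,Y]\otimes fg$. $D$ is the span of commuting elements $d_1,\dots,d_n$,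 and $J\oplus D$ is the semidirect product in which $d_i$ acts on $J$ as the degree derivation $t_i\frac{\partial}{\partial t_i}$ ($K_n$ having degree $0$). $D_k$ is the span of $d_{k+1},\dots,d_n$, so $D_0=D$ and $D_{n-1}=\mathbb C d_n$, and $\mathfrak h_k=\mathfrak h\oplus\mathbb C K_n\oplus D_k$. A weight module with respect to $\mathfrak h_k$ is the direct sum of its simultaneous eigenspaces (weight spaces) for $\mathfrak h_k$. Central operators: on an irreducible $J\oplus D$-module $V$ with finite dimensional weight spaces, every element $K_n\otimes t^{\overline m}$ that acts as a non-zero operator on $V$ acts invertibly. A central operator on $V$ is a scalar multiple of a finite product of operators by which such elements $K_n\otimes t^{\overline m}$ act, and inverses of such operators; it commutes with the action of $J$, and it has degree $\underline m\in\mathbb Z^n$ if $d_iz-zd_i=m_iz$ for $1\le i\le n$. Module structure $\pi(\alpha)$ on $V_1\otimes A_{n-1}$, for $\alpha=(\alpha_1,\dots,\alpha_{n-1})\in\mathbb C^{n-1}$: writing $v(\overline p)=v\otimes t^{\overline p}$ and $X(\overline m)=X\otimes t^{\overline m}$ ($X\in\mathfrak g_{\rm aff}$), $X(\overline m)\cdot v(\overline p)=(X(\overline m)v)(\overline m+\overline p)$, $d_n\cdot v(\overline p)=(d_nv)(\overline p)$, $d_i\cdot v(\overline p)=(\alpha_i+p_i)v(\overline p)$ for $1\le i\le n-1$. *)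

theory Defs
  imports "HOL-Analysis.Analysis" "HOL-Library.Poly_Mapping" "HOL-Library.Set_Algebras"
begin

section \<open>Finite dimensional simple Lie algebras over the complex numbers\<close>

locale lie_algebra = vector_space scale
  for scale :: "complex \<Rightarrow> 'g::ab_group_add \<Rightarrow> 'g" +
  fixes bracket :: "'g \<Rightarrow> 'g \<Rightarrow> 'g"
  assumes bracket_add_left: "bracket (x + y) z = bracket x z + bracket y z"
    and bracket_add_right: "bracket x (y + z) = bracket x y + bracket x z"
    and bracket_scale_left: "bracket (scale c x) y = scale c (bracket x y)"
    and bracket_scale_right: "bracket x (scale c y) = scale c (bracket x y)"
    and bracket_self: "bracket x x = 0"
    and jacobi: "bracket x (bracket y z) + bracket y (bracket z x) + bracket z (bracket x y) = 0"
begin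

definition finite_dim :: bool where
  "finite_dim \<longleftrightarrow> (\<exists>B. finite B \<and> span B = UNIV)"

definition ideal :: "'g set \<Rightarrow> bool" where
  "ideal I \<longleftrightarrow> subspace I \<and> (\<forall>x. \<forall>y\<in>I. bracket x y \<in> I)"

definition simple :: bool where
  "simple \<longleftrightarrow> (\<exists>x y. bracket x y \<noteq> 0) \<and> (\<forall>I. ideal I \<longrightarrow> I = {0} \<or> I = UNIV)"

definition subalgebra :: "'g set \<Rightarrow> bool" where
  "subalgebra H \<longleftrightarrow> subspace H \<and> (\<forall>x\<in>H. \<forall>y\<in>H. bracket x y \<in> H)"

fun lower_central :: "'g set \<Rightarrow> nat \<Rightarrow> 'g set" where
  "lower_central H 0 = H"
| "lower_central H (Suc j) = span {bracket x y | x y. x \<in> H \<and> y \<in> lower_central H j}"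

definition nilpotent :: "'g set \<Rightarrow> bool" where
  "nilpotent H \<longleftrightarrow> (\<exists>j. lower_central H j = {0})"

definition normalizer :: "'g set \<Rightarrow> 'g set" where
  "normalizer H = {x. \<forall>h\<in>H. bracket x h \<in> H}"

definition cartan_subalgebra :: "'g set \<Rightarrow> bool" where
  "cartan_subalgebra H \<longleftrightarrow> subalgebra H \<and> nilpotent H \<and> normalizer H = H"

definition invariant_form :: "('g \<Rightarrow> 'g \<Rightarrow> complex) \<Rightarrow> bool" where
  "invariant_form form \<longleftrightarrow>
     (\<forall>x y z. form (x + y) z = form x z + form y z) \<and>
     (\<forall>c x y. form (scale c x) y = c * form x y) \<and>
     (\<forall>x y. form x y = form y x) \<and>
     (\<forall>x y z. form (bracket x y) z = form x (bracket y z))"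

definition nondegenerate :: "('g \<Rightarrow> 'g \<Rightarrow> complex) \<Rightarrow> bool" where
  "nondegenerate form \<longleftrightarrow> (\<forall>x. (\<forall>y. form x y = 0) \<longrightarrow> x = 0)"

end


section \<open>The Lie algebra J + D\<close>

text \<open>
  The indices 1, ..., n - 1 are the elements of a finite type \<open>'i\<close>, so n = CARD('i) + 1
  is an arbitrary integer with n >= 2; the index n is kept apart.  The basis element
  \<open>X\<close> tensor \<open>t^m\<close> of a tensor product with Laurent polynomials is \<open>single m X\<close>.
  An element \<open>(f, c)\<close> of \<open>'g aff\<close> stands for \<open>f + c K_n\<close>, and an element
  \<open>(x, a, e)\<close> of \<open>('g, 'i) tor\<close> stands for the sum of \<open>x\<close>, of \<open>e d_n\<close> and of the
  \<open>(a $ i) d_i\<close> with \<open>i\<close> below n.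
\<close>

type_synonym 'g aff = "(int \<Rightarrow>\<^sub>0 'g) \<times> complex"
type_synonym ('g, 'i) mloop = "(int ^ 'i) \<Rightarrow>\<^sub>0 'g aff"
type_synonym ('g, 'i) tor = "('g, 'i) mloop \<times> (complex ^ 'i) \<times> complex"

text \<open>The bilinear extension of \<open>[X t^a, Y t^b] = [X, Y] t^(a+b)\<close>.\<close>

definition loop_bracket ::
  "('x::comm_monoid_add \<Rightarrow> 'x \<Rightarrow> 'x) \<Rightarrow> ('k::monoid_add \<Rightarrow>\<^sub>0 'x) \<Rightarrow> ('k \<Rightarrow>\<^sub>0 'x) \<Rightarrow> ('k \<Rightarrow>\<^sub>0 'x)" where
  "loop_bracket br f g = (\<Sum>a\<in>Poly_Mapping.keys f. \<Sum>b\<in>Poly_Mapping.keys g.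
     Poly_Mapping.single (a + b) (br (Poly_Mapping.lookup f a) (Poly_Mapping.lookup g b)))"

definition aff_scale :: "(complex \<Rightarrow> 'g::ab_group_add \<Rightarrow> 'g) \<Rightarrow> complex \<Rightarrow> 'g aff \<Rightarrow> 'g aff" where
  "aff_scale scaleG c X = (Poly_Mapping.map (scaleG c) (fst X), c * snd X)"

definition aff_bracket ::
  "('g::ab_group_add \<Rightarrow> 'g \<Rightarrow> 'g) \<Rightarrow> ('g \<Rightarrow> 'g \<Rightarrow> complex) \<Rightarrow> 'g aff \<Rightarrow> 'g aff \<Rightarrow> 'g aff" where
  "aff_bracket bracket form X Y =
     (loop_bracket bracket (fst X) (fst Y),
      \<Sum>a\<in>Poly_Mapping.keys (fst X). \<Sum>b\<in>Poly_Mapping.keys (fst Y).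
        if a + b = 0
        then of_int a * form (Poly_Mapping.lookup (fst X) a) (Poly_Mapping.lookup (fst Y) b)
        else 0)"

text \<open>The derivation \<open>t_n d/dt_n\<close> of the affine Lie algebra; it annihilates \<open>K_n\<close>.\<close>

definition aff_degree :: "(complex \<Rightarrow> 'g::ab_group_add \<Rightarrow> 'g) \<Rightarrow> 'g aff \<Rightarrow> 'g aff" where
  "aff_degree scaleG X = (\<Sum>a\<in>Poly_Mapping.keys (fst X).
     Poly_Mapping.single a (scaleG (of_int a) (Poly_Mapping.lookup (fst X) a)), 0)"

definition mloop_deriv ::
  "(complex \<Rightarrow> 'g::ab_group_add \<Rightarrow> 'g) \<Rightarrow> (complex ^ 'i) \<times> complex
     \<Rightarrow> ('g, 'i::finite) mloop \<Rightarrow> ('g, 'i) mloop" where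
  "mloop_deriv scaleG d x = (\<Sum>m\<in>Poly_Mapping.keys x. Poly_Mapping.single m
     (aff_scale scaleG (\<Sum>i\<in>UNIV. fst d $ i * of_int (m $ i)) (Poly_Mapping.lookup x m)
      + aff_scale scaleG (snd d) (aff_degree scaleG (Poly_Mapping.lookup x m))))"

definition tor_scale ::
  "(complex \<Rightarrow> 'g::ab_group_add \<Rightarrow> 'g) \<Rightarrow> complex \<Rightarrow> ('g, 'i::finite) tor \<Rightarrow> ('g, 'i) tor" where
  "tor_scale scaleG c x = (case x of (u, d, e) \<Rightarrow>
     (Poly_Mapping.map (aff_scale scaleG c) u, \<chi> i. c * d $ i, c * e))"

definition tor_bracket ::
  "(complex \<Rightarrow> 'g::ab_group_add \<Rightarrow> 'g) \<Rightarrow> ('g \<Rightarrow> 'g \<Rightarrow> 'g) \<Rightarrow> ('g \<Rightarrow> 'g \<Rightarrow> complex)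
     \<Rightarrow> ('g, 'i::finite) tor \<Rightarrow> ('g, 'i) tor \<Rightarrow> ('g, 'i) tor" where
  "tor_bracket scaleG bracket form x y =
     (loop_bracket (aff_bracket bracket form) (fst x) (fst y)
        + mloop_deriv scaleG (snd x) (fst y) - mloop_deriv scaleG (snd y) (fst x), 0)"

text \<open>\<open>X\<close> tensor \<open>t^m\<close>, \<open>K_n\<close> tensor \<open>t^m\<close>, \<open>d_i\<close> for \<open>i < n\<close>, and \<open>d_n\<close>.\<close>

definition el :: "'g aff \<Rightarrow> int ^ 'i \<Rightarrow> ('g::ab_group_add, 'i::finite) tor" where
  "el X m = (Poly_Mapping.single m X, 0)"

definition central_el :: "int ^ 'i \<Rightarrow> ('g::ab_group_add, 'i::finite) tor" where
  "central_el m = el (0, 1) m"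

definition deg :: "'i \<Rightarrow> ('g::ab_group_add, 'i::finite) tor" where
  "deg i = (0, axis i 1, 0)"

definition deg_last :: "('g::ab_group_add, 'i::finite) tor" where
  "deg_last = (0, 0, 1)"

text \<open>\<open>J + D_(n-1)\<close>, \<open>h_0\<close> and \<open>h_(n-1)\<close> as subsets of \<open>J + D\<close>.\<close>

definition J_D_last :: "('g::ab_group_add, 'i::finite) tor set" where
  "J_D_last = {(x, d, e) | x d e. d = 0}"

definition h_first :: "'g set \<Rightarrow> ('g::ab_group_add, 'i::finite) tor set" where
  "h_first H = {(Poly_Mapping.single 0 (Poly_Mapping.single 0 h, c), d, e) | h c d e. h \<in> H}"

definition h_last :: "'g set \<Rightarrow> ('g::ab_group_add, 'i::finite) tor set" where
  "h_last H = h_first H \<inter> J_D_last"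


section \<open>Modules\<close>

text \<open>
  A vector space with operators indexed by \<open>'l\<close>, with explicit carrier and operations, so that
  quotients can be formed.  The relevant subalgebra \<open>L\<close> of \<open>'l\<close> is an argument of the
  predicates below; the values of \<open>act\<close> outside \<open>L\<close> play no role.
\<close>

record ('l, 'v) lmod =
  car :: "'v set"
  nul :: 'v
  pls :: "'v \<Rightarrow> 'v \<Rightarrow> 'v"
  scl :: "complex \<Rightarrow> 'v \<Rightarrow> 'v"
  act :: "'l \<Rightarrow> 'v \<Rightarrow> 'v"

definition lmod_subspace :: "('l, 'v) lmod \<Rightarrow> 'v set \<Rightarrow> bool" where
  "lmod_subspace M S \<longleftrightarrow> S \<subseteq> car M \<and> nul M \<in> S \<and>
     (\<forall>u\<in>S. \<forall>v\<in>S. pls M u v \<in> S) \<and> (\<forall>c. \<forall>v\<in>S. scl M c v \<in> S)"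

definition lmod_span :: "('l, 'v) lmod \<Rightarrow> 'v set \<Rightarrow> 'v set" where
  "lmod_span M S = \<Inter>{T. lmod_subspace M T \<and> S \<subseteq> T}"

definition lmod_finite_dim :: "('l, 'v) lmod \<Rightarrow> 'v set \<Rightarrow> bool" where
  "lmod_finite_dim M S \<longleftrightarrow> (\<exists>B. finite B \<and> B \<subseteq> car M \<and> lmod_span M B = S)"

definition lmod_sum :: "('l, 'v) lmod \<Rightarrow> ('k \<Rightarrow> 'v) \<Rightarrow> 'k set \<Rightarrow> 'v" where
  "lmod_sum M f A = Finite_Set.fold (\<lambda>a s. pls M (f a) s) (nul M) A"

definition submodule :: "'l set \<Rightarrow> ('l, 'v) lmod \<Rightarrow> 'v set \<Rightarrow> bool" where
  "submodule L M U \<longleftrightarrow> lmod_subspace M U \<and> (\<forall>x\<in>L. \<forall>u\<in>U. act M x u \<in> U)"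

definition irreducible_module :: "'l set \<Rightarrow> ('l, 'v) lmod \<Rightarrow> bool" where
  "irreducible_module L M \<longleftrightarrow> car M \<noteq> {nul M} \<and>
     (\<forall>U. submodule L M U \<longrightarrow> U = {nul M} \<or> U = car M)"

definition maximal_submodule :: "'l set \<Rightarrow> ('l, 'v) lmod \<Rightarrow> 'v set \<Rightarrow> bool" where
  "maximal_submodule L M W \<longleftrightarrow> submodule L M W \<and> W \<noteq> car M \<and>
     (\<forall>U. submodule L M U \<and> W \<subseteq> U \<longrightarrow> U = W \<or> U = car M)"

definition weight_space :: "('l, 'v) lmod \<Rightarrow> 'l set \<Rightarrow> ('l \<Rightarrow> complex) \<Rightarrow> 'v set" where
  "weight_space M H l = {v \<in> car M. \<forall>h\<in>H. act M h v = scl M (l h) v}"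

text \<open>
  Weights are functions on \<open>H\<close>; \<open>extensional H\<close> makes their values outside \<open>H\<close> irrelevant, so
  that different weights in the direct sum decomposition are different on \<open>H\<close>.
\<close>

definition weight_module :: "('l, 'v) lmod \<Rightarrow> 'l set \<Rightarrow> bool" where
  "weight_module M H \<longleftrightarrow>
     lmod_span M (\<Union>l\<in>extensional H. weight_space M H l) = car M \<and>
     (\<forall>l\<in>extensional H. weight_space M H l \<inter>
        lmod_span M (\<Union>l'\<in>extensional H - {l}. weight_space M H l') = {nul M})"

definition finite_dim_weight_spaces :: "('l, 'v) lmod \<Rightarrow> 'l set \<Rightarrow> bool" where
  "finite_dim_weight_spaces M H \<longleftrightarrow> (\<forall>l. lmod_finite_dim M (weight_space M H l))"

text \<open>An irreducible direct summand.\<close>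

definition component :: "'l set \<Rightarrow> ('l, 'v) lmod \<Rightarrow> 'v set \<Rightarrow> bool" where
  "component L M U \<longleftrightarrow> submodule L M U \<and> irreducible_module L (M\<lparr>car := U\<rparr>) \<and>
     (\<exists>U'. submodule L M U' \<and> U \<inter> U' = {nul M} \<and>
        car M = {pls M u u' | u u'. u \<in> U \<and> u' \<in> U'})"

definition module_iso :: "'l set \<Rightarrow> ('l, 'v) lmod \<Rightarrow> ('l, 'w) lmod \<Rightarrow> ('v \<Rightarrow> 'w) \<Rightarrow> bool" where
  "module_iso L M N f \<longleftrightarrow> bij_betw f (car M) (car N) \<and>
     (\<forall>u\<in>car M. \<forall>v\<in>car M. f (pls M u v) = pls N (f u) (f v)) \<and>
     (\<forall>c. \<forall>v\<in>car M. f (scl M c v) = scl N c (f v)) \<and>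
     (\<forall>x\<in>L. \<forall>v\<in>car M. f (act M x v) = act N x (f v))"

definition isomorphic_modules :: "'l set \<Rightarrow> ('l, 'v) lmod \<Rightarrow> ('l, 'w) lmod \<Rightarrow> bool" where
  "isomorphic_modules L M N \<longleftrightarrow> (\<exists>f. module_iso L M N f)"

text \<open>Modules over \<open>J + D\<close> whose underlying space is a whole type.\<close>

definition tor_module ::
  "(complex \<Rightarrow> 'g::ab_group_add \<Rightarrow> 'g) \<Rightarrow> ('g \<Rightarrow> 'g \<Rightarrow> 'g) \<Rightarrow> ('g \<Rightarrow> 'g \<Rightarrow> complex)
     \<Rightarrow> (complex \<Rightarrow> 'v::ab_group_add \<Rightarrow> 'v) \<Rightarrow> (('g, 'i::finite) tor \<Rightarrow> 'v \<Rightarrow> 'v) \<Rightarrow> bool" where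
  "tor_module scaleG bracket form scaleV \<rho> \<longleftrightarrow>
     vector_space scaleV \<and>
     (\<forall>x u v. \<rho> x (u + v) = \<rho> x u + \<rho> x v) \<and>
     (\<forall>x c v. \<rho> x (scaleV c v) = scaleV c (\<rho> x v)) \<and>
     (\<forall>x y v. \<rho> (x + y) v = \<rho> x v + \<rho> y v) \<and>
     (\<forall>c x v. \<rho> (tor_scale scaleG c x) v = scaleV c (\<rho> x v)) \<and>
     (\<forall>x y v. \<rho> (tor_bracket scaleG bracket form x y) v = \<rho> x (\<rho> y v) - \<rho> y (\<rho> x v))"

definition full_lmod ::
  "(complex \<Rightarrow> 'v::ab_group_add \<Rightarrow> 'v) \<Rightarrow> ('l \<Rightarrow> 'v \<Rightarrow> 'v) \<Rightarrow> ('l, 'v) lmod" where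
  "full_lmod scaleV \<rho> = \<lparr>car = UNIV, nul = 0, pls = (+), scl = scaleV, act = \<rho>\<rparr>"

text \<open>
  The quotient by \<open>W\<close>, on the cosets \<open>v +o W\<close>.  The addition is that of sets; a map \<open>f\<close>
  preserving \<open>W\<close> induces \<open>v +o W \<mapsto> f ` (v +o W) + W = f v +o W\<close> (adding \<open>W\<close> matters
  when \<open>f\<close> does not map \<open>W\<close> onto \<open>W\<close>).
\<close>

definition quotient_lmod ::
  "(complex \<Rightarrow> 'v::ab_group_add \<Rightarrow> 'v) \<Rightarrow> ('l \<Rightarrow> 'v \<Rightarrow> 'v) \<Rightarrow> 'v set \<Rightarrow> ('l, 'v set) lmod" where
  "quotient_lmod scaleV \<rho> W =
     \<lparr>car = range (\<lambda>v. v +o W), nul = W, pls = (+),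
      scl = (\<lambda>c A. scaleV c ` A + W), act = (\<lambda>x A. \<rho> x ` A + W)\<rparr>"

text \<open>
  The module \<open>\<pi>(\<alpha>)\<close> on \<open>M\<close> tensor \<open>A_(n-1)\<close>.  A finitely supported function \<open>F\<close> stands for the
  sum of the \<open>F p\<close> tensor \<open>t^p\<close>; the summand \<open>X(m)\<close> of an element of \<open>J\<close> contributes
  \<open>X(m) (F (p - m))\<close> to the coefficient of \<open>t^p\<close>.
\<close>

definition tensor_lmod ::
  "(('g::ab_group_add, 'i::finite) tor, 'w) lmod \<Rightarrow> complex ^ 'i
     \<Rightarrow> (('g, 'i) tor, int ^ 'i \<Rightarrow> 'w) lmod" where
  "tensor_lmod M \<alpha> =
     \<lparr>car = {F. (\<forall>p. F p \<in> car M) \<and> finite {p. F p \<noteq> nul M}},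
      nul = (\<lambda>p. nul M),
      pls = (\<lambda>F G p. pls M (F p) (G p)),
      scl = (\<lambda>c F p. scl M c (F p)),
      act = (\<lambda>(x, d, e) F p.
        pls M (lmod_sum M (\<lambda>m. act M (el (Poly_Mapping.lookup x m) m) (F (p - m)))
                 (Poly_Mapping.keys x))
          (pls M (scl M (\<Sum>i\<in>UNIV. d $ i * (\<alpha> $ i + of_int (p $ i))) (F p))
                 (scl M e (act M deg_last (F p)))))\<rparr>"


section \<open>Central operators\<close>

definition central_generator ::
  "(('g::ab_group_add, 'i::finite) tor \<Rightarrow> 'v::ab_group_add \<Rightarrow> 'v) \<Rightarrow> ('v \<Rightarrow> 'v) \<Rightarrow> bool" where
  "central_generator \<rho> z \<longleftrightarrow> (\<exists>m. z = \<rho> (central_el m)) \<and> z \<noteq> (\<lambda>v. 0)"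

definition central_factor ::
  "(('g::ab_group_add, 'i::finite) tor \<Rightarrow> 'v::ab_group_add \<Rightarrow> 'v) \<Rightarrow> ('v \<Rightarrow> 'v) \<Rightarrow> bool" where
  "central_factor \<rho> z \<longleftrightarrow> central_generator \<rho> z \<or>
     (\<exists>y. central_generator \<rho> y \<and> y \<circ> z = id \<and> z \<circ> y = id)"

definition central_operator ::
  "(complex \<Rightarrow> 'v::ab_group_add \<Rightarrow> 'v) \<Rightarrow> (('g::ab_group_add, 'i::finite) tor \<Rightarrow> 'v \<Rightarrow> 'v)
     \<Rightarrow> ('v \<Rightarrow> 'v) \<Rightarrow> bool" where
  "central_operator scaleV \<rho> z \<longleftrightarrow>
     (\<exists>c zs. (\<forall>y\<in>set zs. central_factor \<rho> y) \<and> z = (\<lambda>v. scaleV c (foldr (\<circ>) zs id v)))"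

text \<open>The degree in \<open>\<int>^n\<close> is \<open>(m, q)\<close>, where \<open>q\<close> is its component at the index n.\<close>

definition has_degree ::
  "(complex \<Rightarrow> 'v::ab_group_add \<Rightarrow> 'v) \<Rightarrow> (('g::ab_group_add, 'i::finite) tor \<Rightarrow> 'v \<Rightarrow> 'v)
     \<Rightarrow> ('v \<Rightarrow> 'v) \<Rightarrow> (int ^ 'i) \<times> int \<Rightarrow> bool" where
  "has_degree scaleV \<rho> z mq \<longleftrightarrow> (case mq of (m, q) \<Rightarrow>
     (\<forall>i v. \<rho> (deg i) (z v) - z (\<rho> (deg i) v) = scaleV (of_int (m $ i)) (z v)) \<and>
     (\<forall>v. \<rho> deg_last (z v) - z (\<rho> deg_last v) = scaleV (of_int q) (z v)))"

end

(*
  Let alpha be the eigenvalue of a common eigenvector of the d_i (i < n).  By irreducibility V is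
  the direct sum of the eigenspaces V_p for the eigenvalues alpha + p, p in Z^(n-1).  Sending v in
  V_p to (v + W) tensor t^p embeds V into (V/W) tensor A_(n-1).  Composing with the multiplication
  by t^q gives an embedding with irreducible image for every q; it is not equivariant, but it
  only changes the action of d_i by the scalar q_i.  These images span the tensor product because
  V is the sum of the V_p.  So the tensor product is a sum of irreducible submodules, and every
  submodule of it, in particular the image for q = 0, has a complement.
*)
theory Submission
  imports Defs
begin

section \<open>Complements in sums of irreducible submodules\<close>

text \<open>The group laws are assumed on the carrier only, since no type class instance stands
  behind the operations of a record; negatives are encoded as \<open>scl M (-1) v\<close>.\<close>

locale lmodule =
  fixes L :: "'l set" and M :: "('l, 'v) lmod"
  assumes nul_closed: "nul M \<in> car M"
    and pls_closed: "u \<in> car M \<Longrightarrow> v \<in> car M \<Longrightarrow> pls M u v \<in> car M"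
    and scl_closed: "v \<in> car M \<Longrightarrow> scl M c v \<in> car M"
    and act_closed: "x \<in> L \<Longrightarrow> v \<in> car M \<Longrightarrow> act M x v \<in> car M"
    and pls_assoc: "u \<in> car M \<Longrightarrow> v \<in> car M \<Longrightarrow> w \<in> car M \<Longrightarrow>
      pls M (pls M u v) w = pls M u (pls M v w)"
    and pls_commute: "u \<in> car M \<Longrightarrow> v \<in> car M \<Longrightarrow> pls M u v = pls M v u"
    and pls_nul: "v \<in> car M \<Longrightarrow> pls M v (nul M) = v"
    and pls_neg: "v \<in> car M \<Longrightarrow> pls M v (scl M (-1) v) = nul M"
    and scl_pls: "u \<in> car M \<Longrightarrow> v \<in> car M \<Longrightarrow>
      scl M c (pls M u v) = pls M (scl M c u) (scl M c v)"
    and act_pls: "x \<in> L \<Longrightarrow> u \<in> car M \<Longrightarrow> v \<in> car M \<Longrightarrow>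
      act M x (pls M u v) = pls M (act M x u) (act M x v)"
begin

lemma nul_pls: "v \<in> car M \<Longrightarrow> pls M (nul M) v = v"
  using pls_nul pls_commute nul_closed by metis

text \<open>Serves to show that additive maps fix the neutral element: the image of
  \<open>nul M\<close> equals its own double.\<close>

lemma pls_self_eq: "v \<in> car M \<Longrightarrow> pls M v v = v \<Longrightarrow> v = nul M"
  by (metis pls_assoc pls_neg pls_nul scl_closed)

lemma scl_nul: "scl M c (nul M) = nul M"
  by (rule pls_self_eq) (metis nul_closed pls_nul scl_closed scl_pls)+

lemma act_nul: "x \<in> L \<Longrightarrow> act M x (nul M) = nul M"
  by (rule pls_self_eq) (metis nul_closed pls_nul act_closed act_pls)+

lemma submoduleI:
  assumes "U \<subseteq> car M" "nul M \<in> U" "\<And>u v. u \<in> U \<Longrightarrow> v \<in> U \<Longrightarrow> pls M u v \<in> U"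
    and "\<And>c u. u \<in> U \<Longrightarrow> scl M c u \<in> U" "\<And>x u. u \<in> U \<Longrightarrow> x \<in> L \<Longrightarrow> act M x u \<in> U"
  shows "submodule L M U"
  using assms unfolding submodule_def lmod_subspace_def by auto

lemma submoduleD:
  assumes "submodule L M U"
  shows "u \<in> U \<Longrightarrow> u \<in> car M" "nul M \<in> U" "u \<in> U \<Longrightarrow> v \<in> U \<Longrightarrow> pls M u v \<in> U"
    and "u \<in> U \<Longrightarrow> scl M c u \<in> U" "u \<in> U \<Longrightarrow> x \<in> L \<Longrightarrow> act M x u \<in> U"
  using assms unfolding submodule_def lmod_subspace_def by auto

lemma submodule_nul: "submodule L M {nul M}"
  by (simp add: submodule_def lmod_subspace_def nul_closed pls_nul scl_nul act_nul)

lemma submodule_inter: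
  "submodule L M U \<Longrightarrow> submodule L M U' \<Longrightarrow> submodule L M (U \<inter> U')"
  by (auto simp: submodule_def lmod_subspace_def)

lemma submodule_pls:
  assumes U: "submodule L M U" and U': "submodule L M U'"
  shows "submodule L M {pls M u u' | u u'. u \<in> U \<and> u' \<in> U'}" (is "submodule L M ?S")
proof (rule submoduleI)
  have c: "u \<in> car M" if "u \<in> U \<or> u \<in> U'" for u
    using that U U' by (auto simp: submodule_def lmod_subspace_def)
  show "?S \<subseteq> car M" using c pls_closed by auto
  show "nul M \<in> ?S"
  proof -
    have "nul M \<in> U" "nul M \<in> U'" using U U' by (auto simp: submodule_def lmod_subspace_def)
    moreover have "nul M = pls M (nul M) (nul M)" by (simp add: pls_nul nul_closed)
    ultimately show ?thesis by blast
  qed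
  show "pls M s t \<in> ?S" if st: "s \<in> ?S" "t \<in> ?S" for s t
  proof -
    from st obtain a a' b b' where ab: "s = pls M a a'" "t = pls M b b'"
      "a \<in> U" "b \<in> U" "a' \<in> U'" "b' \<in> U'" by blast
    have "pls M s t = pls M (pls M a b) (pls M a' b')"
      using ab c pls_closed by (metis pls_assoc pls_commute)
    moreover have "pls M a b \<in> U" "pls M a' b' \<in> U'"
      using ab U U' by (auto simp: submodule_def lmod_subspace_def)
    ultimately show ?thesis by blast
  qed
  show "scl M k s \<in> ?S" if s: "s \<in> ?S" for k s
  proof -
    from s obtain a a' where a: "s = pls M a a'" "a \<in> U" "a' \<in> U'" by blast
    then have "scl M k s = pls M (scl M k a) (scl M k a')" using c scl_pls by auto
    moreover have "scl M k a \<in> U" "scl M k a' \<in> U'"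
      using a U U' by (auto simp: submodule_def lmod_subspace_def)
    ultimately show ?thesis by blast
  qed
  show "act M x s \<in> ?S" if s: "s \<in> ?S" and x: "x \<in> L" for x s
  proof -
    from s obtain a a' where a: "s = pls M a a'" "a \<in> U" "a' \<in> U'" by blast
    then have "act M x s = pls M (act M x a) (act M x a')" using c x act_pls by auto
    moreover have "act M x a \<in> U" "act M x a' \<in> U'"
      using a x U U' by (auto simp: submodule_def)
    ultimately show ?thesis by blast
  qed
qed

text \<open>Two elements of the union lie in a common member because members of a chain are
  comparable. This provides the upper bounds for Zorn's lemma.\<close>

lemma submodule_Union_chain:
  assumes "\<C> \<noteq> {}" and sub: "\<And>U. U \<in> \<C> \<Longrightarrow> submodule L M U" and "subset.chain \<A> \<C>"
  shows "submodule L M (\<Union>\<C>)"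
proof (rule submoduleI)
  show "\<Union>\<C> \<subseteq> car M" using submoduleD(1)[OF sub] by auto
  obtain A where "A \<in> \<C>" using assms(1) by auto
  then show "nul M \<in> \<Union>\<C>" using submoduleD(2)[OF sub] by auto
  show "scl M c u \<in> \<Union>\<C>" if "u \<in> \<Union>\<C>" for c u
    using that submoduleD(4)[OF sub] by auto
  show "act M x u \<in> \<Union>\<C>" if "u \<in> \<Union>\<C>" "x \<in> L" for x u
    using that submoduleD(5)[OF sub] by auto
  show "pls M u v \<in> \<Union>\<C>" if uv: "u \<in> \<Union>\<C>" "v \<in> \<Union>\<C>" for u v
  proof -
    from uv obtain A B where AB: "A \<in> \<C>" "B \<in> \<C>" "u \<in> A" "v \<in> B" by auto
    with assms(3) have "A \<subseteq> B \<or> B \<subseteq> A" by (auto simp: subset_chain_def)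
    then obtain X where X: "X \<in> \<C>" "u \<in> X" "v \<in> X" using AB by auto
    show ?thesis using submoduleD(3)[OF sub[OF X(1)] X(2,3)] X(1) by auto
  qed
qed

text \<open>Irreducibility of \<open>S\<close> speaks of the module with carrier \<open>S\<close>;
  this makes it applicable to submodules found inside \<open>S\<close>.\<close>

lemma submodule_restrict:
  assumes "submodule L M U" "submodule L M S" "U \<subseteq> S"
  shows "submodule L (M\<lparr>car := S\<rparr>) U"
  using assms by (auto simp: submodule_def lmod_subspace_def)

theorem complement_exists:
  assumes U: "submodule L M U"
    and simple: "\<And>S. S \<in> \<S> \<Longrightarrow> submodule L M S \<and> irreducible_module L (M\<lparr>car := S\<rparr>)"
    and spanning: "\<And>N. submodule L M N \<Longrightarrow> \<Union>\<S> \<subseteq> N \<Longrightarrow> N = car M"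
  shows "\<exists>U'. submodule L M U' \<and> U \<inter> U' = {nul M} \<and>
    car M = {pls M u u' | u u'. u \<in> U \<and> u' \<in> U'}"
proof -
  \<comment> \<open>A maximal submodule \<open>U'\<close> meeting \<open>U\<close> trivially works: if an irreducible \<open>S\<close> met \<open>U + U'\<close>
    trivially, then \<open>U' + S\<close> would still meet \<open>U\<close> trivially.\<close>
  let ?A = "{N. submodule L M N \<and> U \<inter> N = {nul M}}"
  have "\<exists>C\<in>?A. \<forall>X\<in>?A. C \<subseteq> X \<longrightarrow> X = C"
  proof (rule subset_Zorn_nonempty)
    have "nul M \<in> U" using U by (simp add: submodule_def lmod_subspace_def)
    then have "{nul M} \<in> ?A" using submodule_nul by blast
    then show "?A \<noteq> {}" by blast
  next
    fix \<C> assume ne: "\<C> \<noteq> {}" and ch: "subset.chain ?A \<C>"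
    then have sub: "\<C> \<subseteq> ?A" by (simp add: subset_chain_def)
    then have "submodule L M (\<Union>\<C>)" by (intro submodule_Union_chain[OF ne _ ch]) blast
    moreover have "U \<inter> \<Union>\<C> = {nul M}" using sub ne by blast
    ultimately show "\<Union>\<C> \<in> ?A" by blast
  qed
  then obtain U' where "U' \<in> ?A" and max: "\<forall>X\<in>?A. U' \<subseteq> X \<longrightarrow> X = U'" by (rule bexE)
  then have U': "submodule L M U'" "U \<inter> U' = {nul M}" by simp_all
  let ?N = "{pls M u u' | u u'. u \<in> U \<and> u' \<in> U'}"
  have N: "submodule L M ?N" by (rule submodule_pls[OF U U'(1)])
  have "S \<subseteq> ?N" if "S \<in> \<S>" for S
  proof -
    have S: "submodule L M S" "irreducible_module L (M\<lparr>car := S\<rparr>)" using simple that by auto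
    have carU: "u \<in> car M" if "u \<in> U \<or> u \<in> U' \<or> u \<in> S" for u
      using that U U' S by (auto simp: submodule_def lmod_subspace_def)
    have "submodule L (M\<lparr>car := S\<rparr>) (S \<inter> ?N)"
      by (rule submodule_restrict[OF submodule_inter[OF S(1) N] S(1)]) blast
    then have "S \<inter> ?N = {nul M} \<or> S \<inter> ?N = S"
      using S(2) by (simp add: irreducible_module_def)
    moreover have False if triv: "S \<inter> ?N = {nul M}"
    proof -
      let ?X = "{pls M u s | u s. u \<in> U' \<and> s \<in> S}"
      have X: "submodule L M ?X" by (rule submodule_pls[OF U'(1) S(1)])
      have nulmem: "nul M \<in> U" "nul M \<in> U'" "nul M \<in> S"
        using U U' S by (auto simp: submodule_def lmod_subspace_def)
      have sub: "U' \<subseteq> ?X" "S \<subseteq> ?X"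
      proof -
        have "u = pls M u (nul M)" if "u \<in> U'" for u using that carU pls_nul by simp
        then show "U' \<subseteq> ?X" using nulmem by blast
        have "s = pls M (nul M) s" if "s \<in> S" for s using that carU nul_pls by simp
        then show "S \<subseteq> ?X" using nulmem by blast
      qed
      \<comment> \<open>If \<open>u = u' + s\<close>, then \<open>s = u - u'\<close> lies in both
        \<open>S\<close> and \<open>?N\<close>, hence vanishes, and \<open>u = u'\<close> lies in
        \<open>U \<inter> U'\<close>.\<close>
      have "U \<inter> ?X \<subseteq> {nul M}"
      proof
        fix u assume "u \<in> U \<inter> ?X"
        then obtain u' s where u: "u \<in> U" "u = pls M u' s" "u' \<in> U'" "s \<in> S" by blast
        have neg: "scl M (-1) u' \<in> U'"
          using u U' by (auto simp: submodule_def lmod_subspace_def)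
        have "pls M u (scl M (-1) u') = pls M s (pls M u' (scl M (-1) u'))"
          using u carU neg by (metis pls_assoc pls_commute)
        also have "\<dots> = s" using u carU pls_neg pls_nul by auto
        finally have "s \<in> ?N" using u(1) neg by blast
        then have "s = nul M" using triv u by blast
        then have "u = u'" using u carU pls_nul by auto
        then show "u \<in> {nul M}" using u U' by blast
      qed
      moreover have "nul M \<in> U \<inter> ?X" using nulmem sub by blast
      ultimately have "U \<inter> ?X = {nul M}" by blast
      \<comment> \<open>Maximality absorbs \<open>S\<close> into \<open>U'\<close> and so into
        \<open>?N\<close>. As \<open>S\<close> meets \<open>?N\<close> trivially, it is zero,
        against its irreducibility.\<close>
      then have "?X = U'" using max X sub(1) by simp
      then have "S \<subseteq> U'" using sub(2) by simp
      moreover have "U' \<subseteq> ?N"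
      proof -
        have "u = pls M (nul M) u" if "u \<in> U'" for u using that carU nul_pls by simp
        then show ?thesis using nulmem by blast
      qed
      ultimately have "S = {nul M}" using triv by blast
      then show False using S(2) by (simp add: irreducible_module_def)
    qed
    ultimately have "S \<inter> ?N = S" by argo
    then show ?thesis unfolding le_iff_inf .
  qed
  \<comment> \<open>The hypothesis \<open>spanning\<close> expresses that the members of
    \<open>\<S>\<close> generate the module without forming sums over infinite families.\<close>
  then have "?N = car M" by (intro spanning[OF N] Union_least)
  then have "car M = ?N" by (rule sym)
  then show ?thesis using U' by (intro exI[of _ U'] conjI)
qed

end

section \<open>Eigenspaces of the degree derivations\<close>

locale tor_rep =
  fixes scaleG :: "complex \<Rightarrow> 'g::ab_group_add \<Rightarrow> 'g"
    and bracket :: "'g \<Rightarrow> 'g \<Rightarrow> 'g"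
    and form :: "'g \<Rightarrow> 'g \<Rightarrow> complex"
    and scaleV :: "complex \<Rightarrow> 'v::ab_group_add \<Rightarrow> 'v"
    and \<rho> :: "('g, 'i::finite) tor \<Rightarrow> 'v \<Rightarrow> 'v"
  assumes vector_space_G: "vector_space scaleG"
    and tor_module: "tor_module scaleG bracket form scaleV \<rho>"
begin

sublocale G: vector_space scaleG by (rule vector_space_G)

sublocale V: vector_space scaleV using tor_module by (simp add: tor_module_def)

lemma rep_add: "\<rho> x (u + v) = \<rho> x u + \<rho> x v"
  and rep_scale: "\<rho> x (scaleV c v) = scaleV c (\<rho> x v)"
  and rep_add_left: "\<rho> (x + y) v = \<rho> x v + \<rho> y v"
  and rep_scale_left: "\<rho> (tor_scale scaleG c x) v = scaleV c (\<rho> x v)"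
  and rep_bracket: "\<rho> (tor_bracket scaleG bracket form x y) v = \<rho> x (\<rho> y v) - \<rho> y (\<rho> x v)"
  using tor_module unfolding tor_module_def by blast+

lemma rep_zero [simp]: "\<rho> x 0 = 0"
  using rep_add[of x 0 0] by simp

lemma rep_zero_left [simp]: "\<rho> 0 v = 0"
  using rep_add_left[of 0 0 v] by simp

lemma rep_sum: "\<rho> x (sum f A) = (\<Sum>a\<in>A. \<rho> x (f a))"
  by (induction A rule: infinite_finite_induct) (simp_all add: rep_add)

lemma rep_sum_left: "\<rho> (sum f A) v = (\<Sum>a\<in>A. \<rho> (f a) v)"
  by (induction A rule: infinite_finite_induct) (simp_all add: rep_add_left)

text \<open>Additivity reduces the action of \<open>J + D\<close> to the elements
  \<open>X(m)\<close>, the \<open>d_i\<close> with \<open>i < n\<close>, and \<open>d_n\<close>;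
  later statements are checked on these.\<close>

lemma rep_decompose:
  "\<rho> (x, d, e) v = (\<Sum>m\<in>Poly_Mapping.keys x. \<rho> (el (Poly_Mapping.lookup x m) m) v)
     + ((\<Sum>i\<in>UNIV. scaleV (d $ i) (\<rho> (deg i) v)) + scaleV e (\<rho> deg_last v))"
proof -
  have x: "x = (\<Sum>m\<in>Poly_Mapping.keys x. Poly_Mapping.single m (Poly_Mapping.lookup x m))"
    by (rule poly_mapping_eqI)
      (simp add: lookup_sum lookup_single when_def not_in_keys_iff_lookup_eq_zero)
  have 1: "(x, 0) = (\<Sum>m\<in>Poly_Mapping.keys x. el (Poly_Mapping.lookup x m) m)"
    by (rule prod_eqI) (simp_all add: fst_sum snd_sum el_def flip: x)
  have map0: "Poly_Mapping.map f 0 = 0" for f :: "'g aff \<Rightarrow> 'g aff"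
    by (rule poly_mapping_eqI) (simp add: Poly_Mapping.map.rep_eq when_def)
  have 2: "(0, d, 0) = (\<Sum>i\<in>UNIV. tor_scale scaleG (d $ i) (deg i))"
    by (intro prod_eqI)
      (auto simp: fst_sum snd_sum tor_scale_def deg_def map0 vec_eq_iff axis_def if_distrib cong: if_cong)
  have 3: "(0, 0, e) = tor_scale scaleG e deg_last"
    by (simp add: tor_scale_def deg_last_def map0 vec_eq_iff)
  have "(x, d, e) = (x, 0) + ((0, d, 0) + (0, 0, e))" by (simp add: zero_prod_def)
  then show ?thesis
    unfolding 1 2 3 by (simp add: rep_add_left rep_sum_left rep_scale_left)
qed

text \<open>The relation \<open>[d_i, X(m)] = m_i X(m)\<close> of \<open>J + D\<close>, transported
  by \<open>rep_bracket\<close>.\<close>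

lemma rep_deg_el:
  "\<rho> (deg i) (\<rho> (el X m) v) = \<rho> (el X m) (\<rho> (deg i) v) + scaleV (of_int (m $ i)) (\<rho> (el X m) v)"
proof -
  have map_single: "Poly_Mapping.map f (Poly_Mapping.single a b) = Poly_Mapping.single a (f b)"
    if "f 0 = 0" for f :: "'c::zero \<Rightarrow> 'd::zero" and a :: 'e and b
    by (rule poly_mapping_eqI) (simp add: Poly_Mapping.map.rep_eq lookup_single when_def that)
  have map_zero: "Poly_Mapping.map (scaleG 0) p = 0" for p :: "int \<Rightarrow>\<^sub>0 'g"
    by (rule poly_mapping_eqI) (simp add: Poly_Mapping.map.rep_eq when_def)
  have map_0: "Poly_Mapping.map f 0 = 0" for f :: "'g \<Rightarrow> 'g"
    by (rule poly_mapping_eqI) (simp add: Poly_Mapping.map.rep_eq when_def)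
  have aff_zero: "aff_scale scaleG c 0 = 0" "aff_scale scaleG 0 Y = 0" for c Y
    by (simp_all add: aff_scale_def map_zero map_0 zero_prod_def)
  have "(\<Sum>j\<in>UNIV. axis i 1 $ j * of_int (m $ j)) = (of_int (m $ i) :: complex)"
    by (simp add: axis_def if_distrib[of "\<lambda>x. x * _"] cong: if_cong)
  \<comment> \<open>The sum in \<open>mloop_deriv\<close> runs over keys, and \<open>m\<close> is a
    key of \<open>single m X\<close> only for nonzero \<open>X\<close>; for \<open>X = 0\<close>
    both sides vanish.\<close>
  then have deriv: "mloop_deriv scaleG (axis i 1, 0) (Poly_Mapping.single m X)
      = Poly_Mapping.single m (aff_scale scaleG (of_int (m $ i)) X)"
    by (cases "X = 0") (simp_all add: mloop_deriv_def aff_zero)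
  have "tor_bracket scaleG bracket form (deg i) (el X m)
      = (Poly_Mapping.single m (aff_scale scaleG (of_int (m $ i)) X), 0)"
    unfolding tor_bracket_def deg_def el_def fst_conv snd_conv deriv
    by (simp add: loop_bracket_def mloop_deriv_def)
  also have "\<dots> = tor_scale scaleG (of_int (m $ i)) (el X m)"
  proof -
    show ?thesis
      unfolding tor_scale_def el_def zero_prod_def[where 'a = "complex ^ 'i" and 'b = complex] prod.case
      by (subst map_single) (simp_all add: aff_zero vec_eq_iff)
  qed
  finally have "tor_bracket scaleG bracket form (deg i) (el X m)
      = tor_scale scaleG (of_int (m $ i)) (el X m)" .
  then show ?thesis
    using rep_bracket[of "deg i" "el X m" v] rep_scale_left[of "of_int (m $ i)" "el X m" v]
    by (simp add: algebra_simps)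
qed

lemma rep_deg_deg_last: "\<rho> (deg i) (\<rho> deg_last v) = \<rho> deg_last (\<rho> (deg i) v)"
proof -
  have "tor_bracket scaleG bracket form (deg i) deg_last = 0"
    by (simp add: tor_bracket_def deg_def deg_last_def loop_bracket_def mloop_deriv_def zero_prod_def)
  then show ?thesis using rep_bracket[of "deg i" deg_last v] by simp
qed

text \<open>The eigenvalue of \<open>d_n\<close> is left free: the degree is to match the exponents
  in A_(n-1), and \<open>d_n\<close> preserves each of these spaces.\<close>

definition deg_space :: "complex ^ 'i \<Rightarrow> int ^ 'i \<Rightarrow> 'v set" where
  "deg_space \<alpha> p = {v. \<forall>i. \<rho> (deg i) v = scaleV (\<alpha> $ i + of_int (p $ i)) v}"

lemma subspace_deg_space: "V.subspace (deg_space \<alpha> p)"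
  by (auto simp: V.subspace_def deg_space_def rep_add rep_scale V.scale_right_distrib V.scale_left_commute)

lemma rep_el_deg_space: "v \<in> deg_space \<alpha> p \<Longrightarrow> \<rho> (el X m) v \<in> deg_space \<alpha> (p + m)"
  by (auto simp: deg_space_def rep_deg_el rep_scale add.assoc simp flip: V.scale_left_distrib)

lemma rep_deg_last_deg_space: "v \<in> deg_space \<alpha> p \<Longrightarrow> \<rho> deg_last v \<in> deg_space \<alpha> p"
  by (auto simp: deg_space_def rep_deg_deg_last rep_scale)

lemma deg_space_independent:
  assumes "finite A" and "\<And>p. p \<in> A \<Longrightarrow> f p \<in> deg_space \<alpha> p" and "sum f A = 0" and "p \<in> A"
  shows "f p = 0"
  using assms
proof (induction A arbitrary: f p rule: finite_induct)
  case empty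
  then show ?case by simp
next
  case (insert a A)
  have other: "f q = 0" if q: "q \<in> A" for q
  proof -
    \<comment> \<open>The operator \<open>d_i - (\<alpha>_i + a_i)\<close> removes the summand at \<open>a\<close>.\<close>
    have "scaleV (of_int (q $ i) - of_int (a $ i)) (f q) = 0" for i
    proof -
      have "(\<Sum>p\<in>insert a A. scaleV (of_int (p $ i) - of_int (a $ i)) (f p))
        = (\<Sum>p\<in>insert a A. \<rho> (deg i) (f p) - scaleV (\<alpha> $ i + of_int (a $ i)) (f p))"
        using insert.prems(1)
        by (intro sum.cong) (auto simp: deg_space_def algebra_simps simp flip: V.scale_left_diff_distrib)
      also have "\<dots> = \<rho> (deg i) (sum f (insert a A)) - scaleV (\<alpha> $ i + of_int (a $ i)) (sum f (insert a A))"
        by (simp only: rep_sum V.scale_sum_right sum_subtractf)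
      also have "\<dots> = 0" by (simp only: insert.prems(2) rep_zero V.scale_zero_right diff_self)
      finally have "(\<Sum>p\<in>A. scaleV (of_int (p $ i) - of_int (a $ i)) (f p)) = 0"
        using insert.hyps by simp
      moreover have "scaleV (of_int (p $ i) - of_int (a $ i)) (f p) \<in> deg_space \<alpha> p" if "p \<in> A" for p
        using insert.prems(1) that subspace_deg_space by (auto simp: V.subspace_def)
      ultimately show ?thesis
        using insert.IH[of "\<lambda>p. scaleV (of_int (p $ i) - of_int (a $ i)) (f p)" q] q by blast
    qed
    \<comment> \<open>Distinct degrees differ in some coordinate, and for that \<open>i\<close> the
      scalar in front of \<open>f q\<close> is invertible.\<close>
    moreover obtain i where "q $ i \<noteq> a $ i" using q insert.hyps by (metis vec_eq_iff)
    ultimately show ?thesis by (metis V.scale_eq_0_iff eq_iff_diff_eq_0 of_int_eq_iff)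
  qed
  then have "f a = 0" using insert.prems(2) insert.hyps by simp
  then show ?case using other insert.prems(3) by auto
qed

text \<open>The span is stable under \<open>J + D\<close>, since \<open>X(m)\<close> shifts the
  degree by \<open>m\<close>, \<open>d_i\<close> acts by a scalar in each degree and
  \<open>d_n\<close> preserves it. It contains \<open>v\<close>, which is nonzero, so irreducibility
  applies.\<close>

lemma span_deg_spaces:
  assumes irr: "irreducible_module UNIV (full_lmod scaleV \<rho>)"
    and "v \<noteq> 0" "v \<in> deg_space \<alpha> p"
  shows "V.span (\<Union>p. deg_space \<alpha> p) = UNIV"
proof -
  let ?S = "V.span (\<Union>p. deg_space \<alpha> p)"
  have "\<rho> x u \<in> ?S" if "u \<in> ?S" for x u
    using that
  proof (induction rule: V.span_induct_alt)
    case base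
    then show ?case by (simp add: V.span_zero)
  next
    case (step c w u)
    then obtain q where w: "w \<in> deg_space \<alpha> q" by blast
    obtain y d e where x: "x = (y, d, e)" by (cases x)
    have "\<rho> (el X m) w \<in> ?S" for X m
      using rep_el_deg_space[OF w] by (intro V.span_base) blast
    moreover have "\<rho> (deg i) w \<in> ?S" for i
      using w V.span_scale[OF V.span_base[of w "\<Union>p. deg_space \<alpha> p"]] by (auto simp: deg_space_def)
    moreover have "\<rho> deg_last w \<in> ?S"
      using rep_deg_last_deg_space[OF w] by (intro V.span_base) blast
    ultimately have "\<rho> x w \<in> ?S"
      unfolding x rep_decompose by (intro V.span_add V.span_sum V.span_scale)
    then show ?case using step by (simp add: rep_add rep_scale V.span_add V.span_scale)
  qed
  then have "submodule UNIV (full_lmod scaleV \<rho>) ?S"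
    by (simp add: submodule_def lmod_subspace_def full_lmod_def V.span_zero V.span_add V.span_scale)
  moreover have "v \<in> ?S" using assms(3) by (intro V.span_base) blast
  ultimately show ?thesis
    using irr assms(2) by (auto simp: irreducible_module_def full_lmod_def)
qed

end

section \<open>Homogeneous components of vectors\<close>

locale graded_tor_rep = tor_rep scaleG bracket form scaleV \<rho>
  for scaleG :: "complex \<Rightarrow> 'g::ab_group_add \<Rightarrow> 'g"
    and bracket :: "'g \<Rightarrow> 'g \<Rightarrow> 'g"
    and form :: "'g \<Rightarrow> 'g \<Rightarrow> complex"
    and scaleV :: "complex \<Rightarrow> 'v::ab_group_add \<Rightarrow> 'v"
    and \<rho> :: "('g, 'i::finite) tor \<Rightarrow> 'v \<Rightarrow> 'v" +
  fixes \<alpha> :: "complex ^ 'i"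
  assumes span_deg_space: "V.span (\<Union>p. deg_space \<alpha> p) = UNIV"
begin

text \<open>These families form the external direct sum of the degree spaces; the following lemmas
  show that \<open>Sum_any\<close> maps it bijectively onto the module.\<close>

definition graded_family :: "(int ^ 'i \<Rightarrow> 'v) \<Rightarrow> bool" where
  "graded_family f \<longleftrightarrow> finite {p. f p \<noteq> 0} \<and> (\<forall>p. f p \<in> deg_space \<alpha> p)"

lemma graded_family_add: "graded_family f \<Longrightarrow> graded_family g \<Longrightarrow> graded_family (\<lambda>p. f p + g p)"
  unfolding graded_family_def
  by (auto intro: V.subspace_add[OF subspace_deg_space]
      finite_subset[of "{p. f p + g p \<noteq> 0}" "{p. f p \<noteq> 0} \<union> {p. g p \<noteq> 0}"])

lemma graded_family_scale: "graded_family f \<Longrightarrow> graded_family (\<lambda>p. scaleV c (f p))"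
  unfolding graded_family_def
  by (auto intro: V.subspace_scale[OF subspace_deg_space]
      finite_subset[of "{p. scaleV c (f p) \<noteq> 0}" "{p. f p \<noteq> 0}"])

lemma Sum_any_scale: "finite {p. f p \<noteq> 0} \<Longrightarrow> Sum_any (\<lambda>p. scaleV c (f p)) = scaleV c (Sum_any f)"
  by (subst (1 2) Sum_any.expand_superset[of "{p. f p \<noteq> 0}"]) (auto simp: V.scale_sum_right)

lemma graded_family_unique:
  assumes "graded_family f" "graded_family g" "Sum_any f = Sum_any g"
  shows "f = g"
proof
  fix p
  \<comment> \<open>The difference of the two families, written so that closure under sums and
    scalar multiples applies. Its sum is 0, so independence of the degree spaces makes every entry
    vanish.\<close>
  let ?h = "\<lambda>p. f p + scaleV (-1) (g p)"
  have h: "graded_family ?h" using assms(1,2) graded_family_add graded_family_scale by blast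
  have "Sum_any ?h = Sum_any f + scaleV (-1) (Sum_any g)"
    using assms(1,2) graded_family_scale[OF assms(2), of "-1"] Sum_any_scale[of g "-1"]
    by (subst Sum_any.distrib) (auto simp: graded_family_def)
  then have "sum ?h {p. ?h p \<noteq> 0} = 0" using assms(3) by (simp add: Sum_any.expand_set)
  then have "?h p = 0"
    using deg_space_independent[of "{p. ?h p \<noteq> 0}" ?h \<alpha> p] h unfolding graded_family_def by auto
  then show "f p = g p" by simp
qed

lemma graded_family_single: "v \<in> deg_space \<alpha> q \<Longrightarrow> graded_family (\<lambda>p. if p = q then v else 0)"
  using V.subspace_0[OF subspace_deg_space] by (auto simp: graded_family_def)

text \<open>An element of the span is built up by one homogeneous summand at a time, each changing
  the family in a single degree.\<close>

lemma graded_family_exists: "\<exists>f. graded_family f \<and> Sum_any f = v"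
proof -
  have "v \<in> V.span (\<Union>p. deg_space \<alpha> p)" by (simp add: span_deg_space)
  then show ?thesis
  proof (induction rule: V.span_induct_alt)
    case base
    show ?case
      by (rule exI[of _ "\<lambda>_. 0"]) (simp add: graded_family_def V.subspace_0[OF subspace_deg_space])
  next
    case (step c w u)
    then obtain q f where w: "w \<in> deg_space \<alpha> q" and f: "graded_family f" "Sum_any f = u" by blast
    let ?w = "\<lambda>p. if p = q then w else 0"
    have gw: "graded_family ?w" by (rule graded_family_single[OF w])
    have "Sum_any ?w = w" by (simp add: Sum_any.expand_superset[of "{q}"])
    then have "Sum_any (\<lambda>p. scaleV c (?w p) + f p) = scaleV c w + u"
      using f gw graded_family_scale[OF gw, of c]
      by (subst Sum_any.distrib) (auto simp: graded_family_def Sum_any_scale simp del: V.scale_eq_0_iff)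
    then show ?case using graded_family_add[OF graded_family_scale[OF gw] f(1)] by blast
  qed
qed

text \<open>\<open>comp v p\<close> is the projection of \<open>v\<close> to degree
  \<open>p\<close>; the description is justified by existence and uniqueness of the
  decomposition.\<close>

definition comp :: "'v \<Rightarrow> int ^ 'i \<Rightarrow> 'v" where
  "comp v = (THE f. graded_family f \<and> Sum_any f = v)"

lemma graded_family_comp: "graded_family (comp v)" and Sum_any_comp: "Sum_any (comp v) = v"
proof -
  have "\<exists>!f. graded_family f \<and> Sum_any f = v"
    using graded_family_exists graded_family_unique by blast
  from theI'[OF this] show "graded_family (comp v)" "Sum_any (comp v) = v"
    unfolding comp_def by auto
qed

lemma finite_comp: "finite {p. comp v p \<noteq> 0}"
  using graded_family_comp by (auto simp: graded_family_def)

lemma comp_unique: "graded_family f \<Longrightarrow> Sum_any f = v \<Longrightarrow> comp v = f"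
  using graded_family_unique graded_family_comp Sum_any_comp by blast

lemma comp_add: "comp (u + v) p = comp u p + comp v p"
proof -
  have "comp (u + v) = (\<lambda>p. comp u p + comp v p)"
    by (rule comp_unique)
      (simp_all add: graded_family_add graded_family_comp Sum_any.distrib finite_comp Sum_any_comp)
  then show ?thesis by simp
qed

lemma comp_scale: "comp (scaleV c v) p = scaleV c (comp v p)"
proof -
  have "comp (scaleV c v) = (\<lambda>p. scaleV c (comp v p))"
    by (rule comp_unique)
      (simp_all add: graded_family_scale graded_family_comp Sum_any_scale finite_comp Sum_any_comp)
  then show ?thesis by simp
qed

lemma comp_homogeneous: "v \<in> deg_space \<alpha> q \<Longrightarrow> comp v p = (if p = q then v else 0)"
proof -
  assume "v \<in> deg_space \<alpha> q"
  then have "comp v = (\<lambda>p. if p = q then v else 0)"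
    by (intro comp_unique graded_family_single) (simp_all add: Sum_any.expand_superset[of "{q}"])
  then show ?thesis by simp
qed

lemma comp_zero: "comp 0 p = 0"
  using comp_scale[of 0 0] by simp

lemma comp_sum: "comp (sum f A) p = (\<Sum>a\<in>A. comp (f a) p)"
  by (induction A rule: infinite_finite_induct) (simp_all add: comp_add comp_zero)

text \<open>Reduces identities linear in \<open>v\<close> to homogeneous vectors, where
  \<open>comp\<close> is explicit. Zero is covered as well, since it belongs to every degree
  space.\<close>

lemma graded_induct [case_names add scale homogeneous]:
  assumes "\<And>u v. P u \<Longrightarrow> P v \<Longrightarrow> P (u + v)" "\<And>c v. P v \<Longrightarrow> P (scaleV c v)"
    and "\<And>v q. v \<in> deg_space \<alpha> q \<Longrightarrow> P v"
  shows "P v"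
proof -
  have "v \<in> V.span (\<Union>p. deg_space \<alpha> p)" by (simp add: span_deg_space)
  then show ?thesis
  proof (induction rule: V.span_induct_alt)
    case base
    show ?case using assms(3) V.subspace_0[OF subspace_deg_space] by blast
  qed (use assms in blast)
qed

text \<open>As \<open>X(m)\<close> shifts degrees by \<open>m\<close>, only the component in degree
  \<open>p - m\<close> contributes to degree \<open>p\<close>.\<close>

lemma comp_el: "comp (\<rho> (el X m) v) p = \<rho> (el X m) (comp v (p - m))"
proof (induction v rule: graded_induct)
  case (homogeneous v q)
  then show ?case
    using comp_homogeneous[OF rep_el_deg_space[OF homogeneous], of X m p]
    by (simp add: comp_homogeneous diff_eq_eq)
qed (simp_all add: rep_add comp_add rep_scale comp_scale)

lemma comp_deg: "comp (\<rho> (deg i) v) p = scaleV (\<alpha> $ i + of_int (p $ i)) (comp v p)"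
proof (induction v rule: graded_induct)
  case (homogeneous v q)
  then have "\<rho> (deg i) v = scaleV (\<alpha> $ i + of_int (q $ i)) v" by (simp add: deg_space_def)
  then show ?case using homogeneous by (simp add: comp_scale comp_homogeneous)
qed (simp_all add: rep_add comp_add rep_scale comp_scale V.scale_right_distrib mult.commute)

lemma comp_deg_last: "comp (\<rho> deg_last v) p = \<rho> deg_last (comp v p)"
proof (induction v rule: graded_induct)
  case (homogeneous v q)
  then show ?case
    using comp_homogeneous[OF rep_deg_last_deg_space[OF homogeneous]]
    by (simp add: comp_homogeneous)
qed (simp_all add: rep_add comp_add rep_scale comp_scale)

text \<open>The right-hand side has the form of the action \<open>\<pi>(\<alpha>)\<close> in the
  coefficient of \<open>t^p\<close>, applied to the family \<open>comp v\<close>. This is the source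
  of the equivariance of the embedding without shift.\<close>

lemma comp_rep:
  "comp (\<rho> (x, d, e) v) p =
     (\<Sum>m\<in>Poly_Mapping.keys x. \<rho> (el (Poly_Mapping.lookup x m) m) (comp v (p - m)))
       + (scaleV (\<Sum>i\<in>UNIV. d $ i * (\<alpha> $ i + of_int (p $ i))) (comp v p)
         + scaleV e (\<rho> deg_last (comp v p)))"
  unfolding rep_decompose
  by (simp add: comp_add comp_sum comp_scale comp_el comp_deg comp_deg_last V.scale_sum_left)

end

section \<open>Embeddings into the tensor product\<close>

text \<open>Stability of \<open>W\<close> is demanded under \<open>J\<close> and \<open>d_n\<close>
  alone, so the quotient by \<open>W\<close> need not inherit the grading; in the tensor product the
  exponent of \<open>t\<close> records the degree instead.\<close>

locale graded_tor_quotient = graded_tor_rep scaleG bracket form scaleV \<rho> \<alpha>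
  for scaleG :: "complex \<Rightarrow> 'g::ab_group_add \<Rightarrow> 'g"
    and bracket :: "'g \<Rightarrow> 'g \<Rightarrow> 'g"
    and form :: "'g \<Rightarrow> 'g \<Rightarrow> complex"
    and scaleV :: "complex \<Rightarrow> 'v::ab_group_add \<Rightarrow> 'v"
    and \<rho> :: "('g, 'i::finite) tor \<Rightarrow> 'v \<Rightarrow> 'v"
    and \<alpha> :: "complex ^ 'i" +
  fixes W :: "'v set"
  assumes submodule_W: "submodule J_D_last (full_lmod scaleV \<rho>) W"
    and W_proper: "W \<noteq> UNIV"
    and irreducible_V: "irreducible_module UNIV (full_lmod scaleV \<rho>)"
begin

section \<open>The quotient and the tensor product computed on representatives\<close>

abbreviation Q :: "(('g, 'i) tor, 'v set) lmod" where
  "Q \<equiv> quotient_lmod scaleV \<rho> W"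

abbreviation T :: "(('g, 'i) tor, int ^ 'i \<Rightarrow> 'v set) lmod" where
  "T \<equiv> tensor_lmod Q \<alpha>"

lemma subspace_W: "V.subspace W"
  using submodule_W by (simp add: submodule_def lmod_subspace_def full_lmod_def V.subspace_def)

lemma rep_W: "x \<in> J_D_last \<Longrightarrow> w \<in> W \<Longrightarrow> \<rho> x w \<in> W"
  using submodule_W by (simp add: submodule_def full_lmod_def)

lemma W_plus_W: "W + W = W"
proof
  show "W + W \<subseteq> W" using V.subspace_add[OF subspace_W] by (auto simp: set_plus_def)
  show "W \<subseteq> W + W"
    using set_plus_intro[OF V.subspace_0[OF subspace_W], of _ W] by auto
qed

lemma coset_eq: "u +o W = v +o W \<longleftrightarrow> u - v \<in> W"
proof
  assume "u +o W = v +o W"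
  moreover have "u \<in> u +o W"
    using set_plus_intro2[OF V.subspace_0[OF subspace_W], of u] by simp
  ultimately show "u - v \<in> W" by (metis set_plus_imp_minus)
next
  assume uv: "u - v \<in> W"
  have le: "a +o W \<subseteq> b +o W" if ab: "a - b \<in> W" for a b
  proof
    fix x assume "x \<in> a +o W"
    then obtain w where "w \<in> W" "x = a + w" by (auto simp: elt_set_plus_def)
    then have "(a - b) + w \<in> W" "x = b + ((a - b) + w)"
      using ab V.subspace_add[OF subspace_W] by auto
    then show "x \<in> b +o W" using set_plus_intro2 by metis
  qed
  from uv have "v - u \<in> W" using V.subspace_neg[OF subspace_W] by fastforce
  then show "u +o W = v +o W" using le uv by blast
qed

lemma coset_add: "(u +o W) + (v +o W) = (u + v) +o W"
  by (simp add: set_plus_rearrange W_plus_W)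

text \<open>The operations of the quotient are images of cosets with \<open>W\<close> added. The
  image of \<open>W\<close> under \<open>f\<close> may be smaller than \<open>W\<close>, but it lies
  in \<open>W\<close> and contains 0, so adding \<open>W\<close> restores the full coset.\<close>

lemma coset_image:
  assumes "\<And>u v. f (u + v) = f u + f v" and "\<And>w. w \<in> W \<Longrightarrow> f w \<in> W"
  shows "f ` (v +o W) + W = f v +o W"
proof -
  have "f ` (v +o W) + W = f v +o (f ` W + W)"
    by (subst set_plus_rearrange3[symmetric])
      (auto simp: elt_set_plus_def image_def assms(1) intro!: arg_cong[of _ _ "\<lambda>A. A + W"])
  also have "f ` W + W = W"
  proof
    show "f ` W + W \<subseteq> W"
      using assms(2) V.subspace_add[OF subspace_W] by (auto simp: set_plus_def)
    have "f 0 = 0" using assms(1)[of 0 0] by simp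
    then have "0 \<in> f ` W" using V.subspace_0[OF subspace_W] by force
    then show "W \<subseteq> f ` W + W" using set_plus_intro[of 0 "f ` W" _ W] by auto
  qed
  finally show ?thesis .
qed

text \<open>Even \<open>nul Q\<close> is written as a coset \<open>0 +o W\<close>, so that all
  operations can be rewritten on representatives.\<close>

lemma car_Q: "car Q = range (\<lambda>v. v +o W)"
  and nul_Q: "nul Q = 0 +o W"
  and pls_Q: "pls Q (u +o W) (v +o W) = (u + v) +o W"
  and scl_Q: "scl Q c (v +o W) = scaleV c v +o W"
  by (simp_all add: quotient_lmod_def coset_add coset_image V.scale_right_distrib
      V.subspace_scale[OF subspace_W])

lemma act_Q: "x \<in> J_D_last \<Longrightarrow> act Q x (v +o W) = \<rho> x v +o W"
  by (simp add: quotient_lmod_def coset_image rep_add rep_W)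

lemma el_J_D_last: "el X m \<in> J_D_last"
  by (simp add: el_def J_D_last_def zero_prod_def)

lemma deg_last_J_D_last: "deg_last \<in> J_D_last"
  by (simp add: deg_last_def J_D_last_def)

lemma lmod_sum_Q: "finite A \<Longrightarrow> lmod_sum Q (\<lambda>a. g a +o W) A = sum g A +o W"
proof (induction A rule: finite_induct)
  case empty
  show ?case by (simp add: lmod_sum_def nul_Q)
next
  case (insert a A)
  \<comment> \<open>The insertion rule for the fold behind \<open>lmod_sum\<close> needs commuting
    functions; addition of arbitrary sets is associative and commutative, so this is not restricted
    to cosets.\<close>
  interpret comp_fun_commute "\<lambda>a. pls Q (g a +o W)"
    by unfold_locales (auto simp: quotient_lmod_def fun_eq_iff add.left_commute)
  show ?case using insert by (simp add: lmod_sum_def pls_Q)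
qed

text \<open>Elements of the tensor product are represented by families in \<open>V\<close> itself,
  which moves the computations from cosets to vectors.\<close>

definition lift :: "(int ^ 'i \<Rightarrow> 'v) \<Rightarrow> int ^ 'i \<Rightarrow> 'v set" where
  "lift g = (\<lambda>p. g p +o W)"

lemma lift_eq: "lift f = lift g \<longleftrightarrow> (\<forall>p. f p - g p \<in> W)"
  by (simp add: lift_def fun_eq_iff coset_eq)

lemma car_T: "car T = {lift g | g. finite {p. g p \<noteq> 0}}"
proof (intro set_eqI iffI)
  fix F assume "F \<in> car T"
  then have F: "\<forall>p. \<exists>v. F p = v +o W" "finite {p. F p \<noteq> 0 +o W}"
    by (auto simp: tensor_lmod_def car_Q nul_Q)
  from F(1) obtain g where g: "\<And>p. F p = g p +o W" by metis
  \<comment> \<open>Arbitrary representatives may be nonzero elements of \<open>W\<close> at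
    infinitely many exponents; representing the zero coset by 0 keeps the support finite.\<close>
  let ?g = "\<lambda>p. if F p = 0 +o W then 0 else g p"
  have "F p = ?g p +o W" for p
  proof (cases "F p = 0 +o W")
    case True
    then show ?thesis by (simp only: refl if_True)
  next
    case False
    then show ?thesis using g[of p] by (simp only: if_False)
  qed
  then have "F = lift ?g" by (auto simp: lift_def)
  moreover have "finite {p. ?g p \<noteq> 0}" by (rule finite_subset[OF _ F(2)]) auto
  ultimately show "F \<in> {lift g | g. finite {p. g p \<noteq> 0}}" by blast
next
  fix F assume "F \<in> {lift g | g. finite {p. g p \<noteq> 0}}"
  then obtain g where "finite {p. g p \<noteq> 0}" "F = lift g" by blast
  moreover from this have "finite {p. lift g p \<noteq> 0 +o W}"
    by (auto simp: lift_def elim!: finite_subset[rotated])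
  ultimately show "F \<in> car T" by (auto simp: tensor_lmod_def car_Q nul_Q lift_def)
qed

lemma nul_T: "nul T = lift (\<lambda>p. 0)"
  and pls_T: "pls T (lift f) (lift g) = lift (\<lambda>p. f p + g p)"
  and scl_T: "scl T c (lift g) = lift (\<lambda>p. scaleV c (g p))"
  by (simp_all add: tensor_lmod_def lift_def nul_Q pls_Q scl_Q)

text \<open>The formula of \<open>\<pi>(\<alpha>)\<close> with \<open>V\<close> in place of its
  quotient: it acts on families of representatives.\<close>

definition tensor_op :: "('g, 'i) tor \<Rightarrow> (int ^ 'i \<Rightarrow> 'v) \<Rightarrow> int ^ 'i \<Rightarrow> 'v" where
  "tensor_op = (\<lambda>(x, d, e) g p.
     (\<Sum>m\<in>Poly_Mapping.keys x. \<rho> (el (Poly_Mapping.lookup x m) m) (g (p - m)))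
       + (scaleV (\<Sum>i\<in>UNIV. d $ i * (\<alpha> $ i + of_int (p $ i))) (g p)
         + scaleV e (\<rho> deg_last (g p))))"

lemma act_T: "act T x (lift g) = lift (tensor_op x g)"
  by (cases x) (simp add: tensor_lmod_def lift_def tensor_op_def act_Q el_J_D_last
      deg_last_J_D_last lmod_sum_Q scl_Q pls_Q)

lemma tensor_op_add: "tensor_op x (\<lambda>p. f p + g p) = (\<lambda>p. tensor_op x f p + tensor_op x g p)"
  by (cases x) (simp add: tensor_op_def fun_eq_iff rep_add sum.distrib V.scale_right_distrib)

lemma finite_tensor_op:
  assumes "finite {p. g p \<noteq> 0}"
  shows "finite {p. tensor_op x g p \<noteq> 0}"
proof (cases x)
  case (fields y d e)
  let ?A = "{p. g p \<noteq> 0}"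
  \<comment> \<open>The derivations do not enlarge the support, and the summand of \<open>y\<close>
    at \<open>m\<close> translates it by \<open>m\<close>.\<close>
  let ?B = "?A \<union> (\<Union>m\<in>Poly_Mapping.keys y. (\<lambda>p. p + m) ` ?A)"
  have "tensor_op x g p = 0" if p: "p \<notin> ?B" for p
  proof -
    have "g (p - m) = 0" if "m \<in> Poly_Mapping.keys y" for m
    proof (rule ccontr)
      assume "g (p - m) \<noteq> 0"
      then have "p \<in> (\<lambda>p. p + m) ` ?A" by (intro image_eqI[of _ _ "p - m"]) auto
      then show False using p that by blast
    qed
    then show ?thesis using p by (simp add: fields tensor_op_def)
  qed
  then have "{p. tensor_op x g p \<noteq> 0} \<subseteq> ?B" by blast
  then show ?thesis by (rule finite_subset) (use assms in auto)
qed

lemma lift_closed: "finite {p. g p \<noteq> 0} \<Longrightarrow> lift g \<in> car T"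
  by (auto simp: car_T)

lemma finite_support_add:
  "finite {p. f p \<noteq> 0} \<Longrightarrow> finite {p. g p \<noteq> 0} \<Longrightarrow> finite {p. f p + g p \<noteq> (0 :: 'v)}"
  by (rule finite_subset[of _ "{p. f p \<noteq> 0} \<union> {p. g p \<noteq> 0}"]) auto

text \<open>Each law is checked on families of representatives, where it follows from a law of
  \<open>V\<close>. This makes \<open>complement_exists\<close> available.\<close>

lemma lmodule_T: "lmodule UNIV T"
proof
  show "nul T \<in> car T" by (simp add: nul_T lift_closed)
  show "pls T u v \<in> car T" if "u \<in> car T" "v \<in> car T" for u v
  proof -
    from that obtain f g where "finite {p. f p \<noteq> 0}" "u = lift f" "finite {p. g p \<noteq> 0}" "v = lift g"
      unfolding car_T by blast
    then show ?thesis by (simp add: pls_T lift_closed finite_support_add)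
  qed
  show "scl T c v \<in> car T" if "v \<in> car T" for c v
  proof -
    from that obtain g where "finite {p. g p \<noteq> 0}" "v = lift g" unfolding car_T by blast
    moreover from this have "finite {p. scaleV c (g p) \<noteq> 0}"
      by (auto elim!: finite_subset[rotated])
    ultimately show ?thesis by (simp add: scl_T lift_closed)
  qed
  show "act T x v \<in> car T" if "v \<in> car T" for x v
  proof -
    from that obtain g where "finite {p. g p \<noteq> 0}" "v = lift g" unfolding car_T by blast
    then show ?thesis by (simp add: act_T lift_closed finite_tensor_op)
  qed
qed (auto simp: car_T pls_T nul_T scl_T act_T tensor_op_add add_ac V.scale_right_distrib)

sublocale T: lmodule UNIV T by (rule lmodule_T)

section \<open>The shifted embeddings, their kernels and their images\<close>

text \<open>On a vector \<open>v\<close> of degree \<open>p\<close> this is \<open>(v + W)\<close>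
  tensor \<open>t^(p+q)\<close>; hence the coefficient at \<open>p\<close> of a general image comes
  from degree \<open>p - q\<close>.\<close>

definition emb :: "int ^ 'i \<Rightarrow> 'v \<Rightarrow> int ^ 'i \<Rightarrow> 'v set" where
  "emb q v = lift (\<lambda>p. comp v (p - q))"

lemma emb_closed: "emb q v \<in> car T"
proof -
  have "finite ((\<lambda>p. p + q) ` {p. comp v p \<noteq> 0})" by (simp add: finite_comp)
  moreover have "{p. comp v (p - q) \<noteq> 0} \<subseteq> (\<lambda>p. p + q) ` {p. comp v p \<noteq> 0}"
    by (auto intro!: image_eqI[of _ _ "_ - q"])
  ultimately show ?thesis unfolding emb_def by (intro lift_closed) (rule finite_subset)
qed

lemma emb_zero: "emb q 0 = nul T"
  and emb_add: "emb q (u + v) = pls T (emb q u) (emb q v)"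
  and emb_scale: "emb q (scaleV c v) = scl T c (emb q v)"
  by (simp_all add: emb_def nul_T pls_T scl_T comp_zero comp_add comp_scale)

text \<open>Multiplication by \<open>t^q\<close> commutes with every \<open>X(m)\<close> and with
  \<open>d_n\<close>, while it raises the eigenvalue of \<open>d_i\<close> by \<open>q_i\<close>.
  The extra scalar collects these shifts.\<close>

lemma act_emb:
  "act T (x, d, e) (emb q v) = emb q (\<rho> (x, d, e) v + scaleV (\<Sum>i\<in>UNIV. d $ i * of_int (q $ i)) v)"
proof -
  have "tensor_op (x, d, e) (\<lambda>p. comp v (p - q)) p
    = comp (\<rho> (x, d, e) v + scaleV (\<Sum>i\<in>UNIV. d $ i * of_int (q $ i)) v) (p - q)" for p
  proof -
    have "(\<Sum>i\<in>UNIV. d $ i * (\<alpha> $ i + of_int (p $ i)))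
      = (\<Sum>i\<in>UNIV. d $ i * (\<alpha> $ i + of_int ((p - q) $ i))) + (\<Sum>i\<in>UNIV. d $ i * of_int (q $ i))"
      by (simp add: algebra_simps flip: sum.distrib)
    then have s: "scaleV (\<Sum>i\<in>UNIV. d $ i * (\<alpha> $ i + of_int (p $ i))) w
      = scaleV (\<Sum>i\<in>UNIV. d $ i * (\<alpha> $ i + of_int ((p - q) $ i))) w
        + scaleV (\<Sum>i\<in>UNIV. d $ i * of_int (q $ i)) w" for w
      by (simp only: V.scale_left_distrib)
    have shift: "p - m - q = p - q - m" for m by simp
    show ?thesis
      unfolding comp_add comp_rep comp_scale tensor_op_def prod.case s shift by simp
  qed
  then have "tensor_op (x, d, e) (\<lambda>p. comp v (p - q)) =
    (\<lambda>p. comp (\<rho> (x, d, e) v + scaleV (\<Sum>i\<in>UNIV. d $ i * of_int (q $ i)) v) (p - q))"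
    by (rule ext)
  then show ?thesis by (simp add: emb_def act_T)
qed

text \<open>The extra term in \<open>act_emb\<close> is a scalar multiple of the vector and can be
  subtracted inside \<open>N\<close>. So the preimage is a submodule of \<open>V\<close> although
  \<open>emb q\<close> need not be equivariant, and irreducibility leaves two cases.\<close>

lemma emb_preimage:
  assumes N: "submodule UNIV T N"
  shows "{v. emb q v \<in> N} = {0} \<or> {v. emb q v \<in> N} = UNIV"
proof -
  have "emb q (\<rho> x v) \<in> N" if v: "emb q v \<in> N" for x v
  proof (cases x)
    case (fields y d e)
    let ?c = "\<Sum>i\<in>UNIV. d $ i * of_int (q $ i)"
    have "\<rho> x v = (\<rho> x v + scaleV ?c v) + scaleV (- ?c) v" by simp
    then have "emb q (\<rho> x v) = pls T (act T x (emb q v)) (scl T (- ?c) (emb q v))"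
      using act_emb[of y d e q v] emb_add emb_scale fields by metis
    then show ?thesis using T.submoduleD[OF N] v by simp
  qed
  then have "submodule UNIV (full_lmod scaleV \<rho>) {v. emb q v \<in> N}"
    using T.submoduleD[OF N]
    by (simp add: submodule_def lmod_subspace_def full_lmod_def emb_zero emb_add emb_scale)
  then show ?thesis using irreducible_V by (simp add: irreducible_module_def full_lmod_def)
qed

text \<open>The kernel is the preimage of the zero submodule. Were it all of \<open>V\<close>, every
  component of every vector would lie in \<open>W\<close>, and so would their sum, against
  \<open>W \<noteq> UNIV\<close>.\<close>

lemma emb_eq_nul: "emb q v = nul T \<longleftrightarrow> v = 0"
proof -
  have "{v. emb q v \<in> {nul T}} \<noteq> UNIV"
  proof
    assume a: "{v. emb q v \<in> {nul T}} = UNIV"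
    have "v \<in> W" for v
    proof -
      have "lift (\<lambda>p. comp v (p - q)) = lift (\<lambda>p. 0)" using a by (auto simp: emb_def nul_T)
      then have "\<forall>p. comp v (p - q) \<in> W" by (simp add: lift_eq)
      then have "comp v p \<in> W" for p by (metis add_diff_cancel_right')
      then have "Sum_any (comp v) \<in> W"
        unfolding Sum_any.expand_set by (intro V.subspace_sum[OF subspace_W])
      then show ?thesis by (simp add: Sum_any_comp)
    qed
    then show False using W_proper by blast
  qed
  then have "{v. emb q v \<in> {nul T}} = {0}" using emb_preimage[OF T.submodule_nul] by blast
  then show ?thesis by blast
qed

lemma inj_emb: "inj (emb q)"
proof (rule injI)
  fix u v assume uv: "emb q u = emb q v"
  have "u - v = u + scaleV (-1) v" by simp
  then have "emb q (u - v) = pls T (emb q u) (scl T (-1) (emb q v))"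
    by (metis emb_add emb_scale)
  then have "emb q (u - v) = nul T" using uv T.pls_neg emb_closed by simp
  then show "u = v" by (simp add: emb_eq_nul)
qed

lemma submodule_range_emb: "submodule UNIV T (range (emb q))"
proof (rule T.submoduleI)
  show "range (emb q) \<subseteq> car T" using emb_closed by blast
  show "nul T \<in> range (emb q)" using emb_zero[of q] by (metis rangeI)
  show "pls T u v \<in> range (emb q)" if "u \<in> range (emb q)" "v \<in> range (emb q)" for u v
    using that by (auto simp flip: emb_add)
  show "scl T c u \<in> range (emb q)" if "u \<in> range (emb q)" for c u
    using that by (auto simp flip: emb_scale)
  show "act T x u \<in> range (emb q)" if "u \<in> range (emb q)" for x u
    using that by (cases x) (auto simp: act_emb)
qed

text \<open>A submodule of the image is the image of its preimage, which \<open>emb_preimage\<close>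
  forces to be 0 or everything.\<close>

lemma irreducible_range_emb: "irreducible_module UNIV (T\<lparr>car := range (emb q)\<rparr>)"
proof -
  obtain v :: 'v where "v \<noteq> 0"
    using irreducible_V by (auto simp: irreducible_module_def full_lmod_def)
  then have "range (emb q) \<noteq> {nul T}" using emb_eq_nul by blast
  moreover have "N = {nul T} \<or> N = range (emb q)"
    if N: "submodule UNIV (T\<lparr>car := range (emb q)\<rparr>) N" for N
  proof -
    have sub: "N \<subseteq> range (emb q)" using N by (simp add: submodule_def lmod_subspace_def)
    then have "N \<subseteq> car T" using emb_closed by blast
    then have "submodule UNIV T N" using N by (simp add: submodule_def lmod_subspace_def)
    then have "{v. emb q v \<in> N} = {0} \<or> {v. emb q v \<in> N} = UNIV" by (rule emb_preimage)
    moreover have "N = emb q ` {v. emb q v \<in> N}" using sub by blast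
    ultimately show ?thesis by (metis emb_zero image_empty image_insert)
  qed
  ultimately show ?thesis by (simp add: irreducible_module_def)
qed

text \<open>It suffices to reach each \<open>(v + W)\<close> tensor \<open>t^p\<close>, and by
  linearity only for homogeneous \<open>v\<close>, since finitely many such elements add up to any
  given one.\<close>

lemma range_emb_spanning:
  assumes N: "submodule UNIV T N" and sub: "\<And>q. range (emb q) \<subseteq> N"
  shows "N = car T"
proof -
  have single: "lift (\<lambda>r. if r = p then v else 0) \<in> N" for p v
  proof (induction v rule: graded_induct)
    case (add u v)
    have "(\<lambda>r. if r = p then u + v else 0)
      = (\<lambda>r. (if r = p then u else 0) + (if r = p then v else 0))" by auto
    then show ?case using T.submoduleD(3)[OF N add] by (simp add: pls_T)
  next
    case (scale c v)
    have "(\<lambda>r. if r = p then scaleV c v else 0) = (\<lambda>r. scaleV c (if r = p then v else 0))" by auto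
    then show ?case using T.submoduleD(4)[OF N scale, of c] by (simp add: scl_T)
  next
    case (homogeneous v q)
    \<comment> \<open>A vector of degree \<open>q\<close> is brought to the exponent
      \<open>p\<close> by the shift \<open>p - q\<close>; this is why images for all shifts are
      used.\<close>
    have "(\<lambda>r. if r = p then v else 0) = (\<lambda>r. comp v (r - (p - q)))"
      by (auto simp: comp_homogeneous[OF homogeneous])
    then have "lift (\<lambda>r. if r = p then v else 0) = emb (p - q) v" by (simp add: emb_def)
    then show ?case using sub by auto
  qed
  have partial: "lift (\<lambda>r. if r \<in> A then g r else 0) \<in> N" if "finite A" for A g
    using that
  proof (induction A rule: finite_induct)
    case empty
    then show ?case using T.submoduleD(2)[OF N] by (simp add: nul_T)
  next
    case (insert a A)
    have "(\<lambda>r. if r \<in> insert a A then g r else 0)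
      = (\<lambda>r. (if r = a then g a else 0) + (if r \<in> A then g r else 0))"
      using insert.hyps by auto
    then show ?case using T.submoduleD(3)[OF N single insert.IH] by (simp add: pls_T)
  qed
  have "lift g \<in> N" if "finite {p. g p \<noteq> 0}" for g
  proof -
    have "(\<lambda>r. if r \<in> {p. g p \<noteq> 0} then g r else 0) = g" by auto
    then show ?thesis using partial[OF that, of g] by simp
  qed
  then have "car T \<subseteq> N" by (auto simp: car_T)
  then show ?thesis using N by (auto simp: submodule_def lmod_subspace_def)
qed

text \<open>The images for all shifts are irreducible and generate the tensor product, so each of
  them has a complement.\<close>

lemma component_range_emb: "component UNIV T (range (emb q))"
proof -
  have "\<exists>U'. submodule UNIV T U' \<and> range (emb q) \<inter> U' = {nul T} \<and>
    car T = {pls T u u' | u u'. u \<in> range (emb q) \<and> u' \<in> U'}"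
  proof (rule T.complement_exists[OF submodule_range_emb])
    show "submodule UNIV T S \<and> irreducible_module UNIV (T\<lparr>car := S\<rparr>)"
      if "S \<in> range (\<lambda>q. range (emb q))" for S
      using that submodule_range_emb irreducible_range_emb by auto
    show "N = car T" if "submodule UNIV T N" "\<Union>(range (\<lambda>q. range (emb q))) \<subseteq> N" for N
      using that(2) by (intro range_emb_spanning[OF that(1)]) blast
  qed
  then show ?thesis
    unfolding component_def using submodule_range_emb irreducible_range_emb by simp
qed

text \<open>For \<open>q = 0\<close> the extra scalar in \<open>act_emb\<close> vanishes, so this
  embedding is equivariant.\<close>

lemma module_iso_emb:
  "module_iso UNIV (full_lmod scaleV \<rho>) (T\<lparr>car := range (emb 0)\<rparr>) (emb 0)"
proof -
  have "act T x (emb 0 v) = emb 0 (\<rho> x v)" for x v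
    by (cases x) (simp add: act_emb)
  then show ?thesis
    using inj_emb[of 0]
    by (simp add: module_iso_def full_lmod_def bij_betw_def emb_add emb_scale)
qed

end

section \<open>A common eigenvector of the derivations and the choice of \<alpha>\<close>

text \<open>If all weight spaces were zero, so would be their span, which is the whole nonzero
  module.\<close>

lemma exists_weight_vector:
  assumes "vector_space scaleV"
    and "irreducible_module UNIV (full_lmod scaleV \<rho>)"
    and "weight_module (full_lmod scaleV \<rho>) H"
  shows "\<exists>l v. v \<noteq> 0 \<and> v \<in> weight_space (full_lmod scaleV \<rho>) H l"
proof (rule ccontr)
  interpret vector_space scaleV by (rule assms(1))
  let ?M = "full_lmod scaleV \<rho>"
  assume "\<not> ?thesis"
  then have "(\<Union>l\<in>extensional H. weight_space ?M H l) \<subseteq> {0}" by blast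
  moreover have "lmod_subspace ?M {0}" by (simp add: lmod_subspace_def full_lmod_def)
  ultimately have "lmod_span ?M (\<Union>l\<in>extensional H. weight_space ?M H l) \<subseteq> {0}"
    unfolding lmod_span_def by blast
  then show False
    using assms(2,3) by (auto simp: weight_module_def irreducible_module_def full_lmod_def)
qed

theorem mainTheorem12:
  fixes scaleG :: "complex \<Rightarrow> 'g::ab_group_add \<Rightarrow> 'g"
    and bracket :: "'g \<Rightarrow> 'g \<Rightarrow> 'g"
    and form :: "'g \<Rightarrow> 'g \<Rightarrow> complex"
    and H :: "'g set"
    and scaleV :: "complex \<Rightarrow> 'v::ab_group_add \<Rightarrow> 'v"
    and \<rho> :: "('g, 'i::finite) tor \<Rightarrow> 'v \<Rightarrow> 'v"
    and z :: "'i \<Rightarrow> 'v \<Rightarrow> 'v"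
    and k :: "'i \<Rightarrow> int"
    and W :: "'v set"
  assumes "lie_algebra scaleG bracket"
    and "lie_algebra.finite_dim scaleG"
    and "lie_algebra.simple scaleG bracket"
    and "lie_algebra.cartan_subalgebra scaleG bracket H"
    and "lie_algebra.invariant_form scaleG bracket form"
    and "lie_algebra.nondegenerate form"
    and "tor_module scaleG bracket form scaleV \<rho>"
    and "irreducible_module UNIV (full_lmod scaleV \<rho>)"
    and "weight_module (full_lmod scaleV \<rho>) (h_first H)"
    and "finite_dim_weight_spaces (full_lmod scaleV \<rho>) (h_first H)"
    and "\<And>i. k i > 0"
    and "\<And>i. z i \<noteq> (\<lambda>v. 0)"
    and "\<And>i. central_operator scaleV \<rho> (z i)"
    and "\<And>i. has_degree scaleV \<rho> (z i) (axis i (k i), 0)"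
    and "maximal_submodule J_D_last (full_lmod scaleV \<rho>) W"
    and "irreducible_module J_D_last (quotient_lmod scaleV \<rho> W)"
    and "finite_dim_weight_spaces (quotient_lmod scaleV \<rho> W) (h_last H)"
  shows "\<exists>\<alpha> U. component UNIV (tensor_lmod (quotient_lmod scaleV \<rho> W) \<alpha>) U \<and>
    isomorphic_modules UNIV (full_lmod scaleV \<rho>)
      ((tensor_lmod (quotient_lmod scaleV \<rho> W) \<alpha>)\<lparr>car := U\<rparr>)"
proof -
  interpret G: lie_algebra scaleG bracket by fact
  interpret R: tor_rep scaleG bracket form scaleV \<rho>
    by unfold_locales fact
  obtain l v where "v \<noteq> 0" and v: "v \<in> weight_space (full_lmod scaleV \<rho>) (h_first H) l"
    using exists_weight_vector[OF R.V.vector_space_axioms] assms by blast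
  \<comment> \<open>Elements of \<open>h_first H\<close> carry a component in \<open>H\<close>; for
    \<open>d_i\<close> this component is 0.\<close>
  have "0 \<in> H"
    using \<open>G.cartan_subalgebra H\<close> G.subspace_0
    by (auto simp: G.cartan_subalgebra_def G.subalgebra_def)
  then have "deg i \<in> h_first H" for i :: 'i
    unfolding h_first_def deg_def
    by (intro CollectI exI[of _ 0] exI[of _ "axis i 1"]) (auto simp: zero_prod_def[symmetric])
  then have "\<rho> (deg i) v = scaleV (l (deg i)) v" for i
    using v by (simp add: weight_space_def full_lmod_def)
  \<comment> \<open>The parameter \<alpha> consists of the eigenvalues of the \<open>d_i\<close> on
    the weight vector \<open>v\<close>, which thereby gets degree 0.\<close>
  then have "v \<in> R.deg_space (\<chi> i. l (deg i)) 0" by (simp add: R.deg_space_def)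
  then have span: "R.V.span (\<Union>p. R.deg_space (\<chi> i. l (deg i)) p) = UNIV"
    using R.span_deg_spaces assms(8) \<open>v \<noteq> 0\<close> by blast
  \<comment> \<open>Maximality of \<open>W\<close> supplies both its stability under
    \<open>J_D_last\<close> and its properness.\<close>
  interpret E: graded_tor_quotient scaleG bracket form scaleV \<rho> "\<chi> i. l (deg i)" W
    using span assms(8,15)
    by unfold_locales (simp_all add: maximal_submodule_def full_lmod_def)
  \<comment> \<open>The component is the image of \<open>emb 0\<close>, and \<open>emb 0\<close>
    itself is the isomorphism.\<close>
  show ?thesis
    using E.component_range_emb E.module_iso_emb unfolding isomorphic_modules_def by blast
qed

end
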